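(* Let $f:\mathbb{R}^N\to\mathbb{R}$ be continuously differentiable, let $S=\{x\in\mathbb{R}^N : \|x\|_0\le s\}$, and consider the problem $\min f(x)$ subject to $x\in S$. Let $\alpha>0$ and $x^*\in S$. If $\|x^*\|_0=s$, then: $x^*$ is an $\alpha$-stationary point $\Longrightarrow$ $x^*$ is an $N^B$-stationary point $\Longleftrightarrow$ $x^*$ is a $T^B$-stationary point. If $\|x^*\|_0<s$, then: $x^*$ is an $\alpha$-stationary point $\Longleftrightarrow$ $x^*$ is an $N^B$-stationary point $\Longleftrightarrow$ $x^*$ is a $T^B$-stationary point $\Longleftrightarrow$ $\nabla f(x^* )=0$.
   Context: $N$ and $s$ are positive integers with $s<N$; $\|x\|_0$ is the number of nonzero entries of $x\in\mathbb{R}^N$; $\|\cdot\|$ is the Euclidean norm. $P_S(x)=\arg\min_{y\in S}\|x-y\|$ is the (set-valued) projection onto $S$. The Bouligand tangent cone of a nonempty set $\Omega\subseteq\mathbb{R}^N$ at $\overline{x}\in\Omega$ is $$T^B_\Omega(\overline{x})=\Big\{d\in\mathbb{R}^N : \exists \{x^k\}\subset\Omega,\ \lim_{k\to\infty}x^k=\overline{x},\ \lambda_k\ge0\ (k=1,2,\dots),\ \text{such that } \lim_{k\to\infty}\lambda_k(x^k-\overline{x})=d\Big\},$$ and $N^B_\Omega(\overline{x})=\{d\in\mathbb{R}^N : \langle d,z\rangle\le0\ \ \forall z\in T^B_\Omega(\overline{x})\}$. A point $x^*\in S$ is called: - an $\alpha$-stationary point if $x^*\in P_S(x^*-\alpha\nabla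 f(x^* ))$; - an $N^B$-stationary point if $0\in\nabla f(x^* )+N^B_S(x^* )$; - a $T^B$-stationary point if $\|\nabla^B_S f(x^* )\|=0$, where $\nabla^B_S f(x^* )=\arg\min\{\|d+\nabla f(x^* )\| : d\in T^B_S(x^* )\}$ (i.e. this set of minimizers is $\{0\}$). *)

theory Defs
  imports "HOL-Analysis.Analysis"
begin

definition gradient :: "('a::euclidean_space \<Rightarrow> real) \<Rightarrow> 'a \<Rightarrow> 'a" where
  "gradient f x = (THE D. GDERIV f x :> D)"

text \<open>The gradient is well defined wherever the function is differentiable.\<close>

lemma GDERIV_gradient:
  fixes f :: "'a::euclidean_space \<Rightarrow> real"
  assumes "f differentiable at x"
  shows "GDERIV f x :> gradient f x"
proof -
  obtain f' where f': "(f has_derivative f') (at x)"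
    using assms by (auto simp: differentiable_def)
  then have lin: "linear f'"
    by (rule has_derivative_linear)
  have f'_eq: "f' = (\<lambda>h. inner h (adjoint f' 1))"
  proof
    fix h
    show "f' h = inner h (adjoint f' 1)"
      using adjoint_works[OF lin, of h 1] by simp
  qed
  have ex: "GDERIV f x :> adjoint f' 1"
    using f' f'_eq by (simp add: gderiv_def)
  have uniq: "D = adjoint f' 1" if "GDERIV f x :> D" for D
  proof -
    have "(\<lambda>h. inner h D) = (\<lambda>h. inner h (adjoint f' 1))"
      using that ex unfolding gderiv_def by (rule has_derivative_unique)
    then show ?thesis
      by (metis inner_commute vector_eq_rdot)
  qed
  show ?thesis
    unfolding gradient_def using ex uniq by (rule theI)
qed

definition continuously_differentiable :: "('a::euclidean_space \<Rightarrow> real) \<Rightarrow> bool" where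
  "continuously_differentiable f \<longleftrightarrow>
     (\<forall>x. f differentiable at x) \<and> continuous_on UNIV (gradient f)"

definition l0_norm :: "real ^ 'n \<Rightarrow> nat" where
  "l0_norm x = card {i. x $ i \<noteq> 0}"

definition sparse_set :: "nat \<Rightarrow> (real ^ 'n) set" where
  "sparse_set s = {x. l0_norm x \<le> s}"

definition projection :: "'a::real_normed_vector set \<Rightarrow> 'a \<Rightarrow> 'a set" where
  "projection S x = {y. is_arg_min (\<lambda>y. norm (x - y)) (\<lambda>y. y \<in> S) y}"

text \<open>The cones are meant for base points of the set only.\<close>

definition bouligand_tangent_cone :: "'a::real_normed_vector set \<Rightarrow> 'a \<Rightarrow> 'a set" where
  "bouligand_tangent_cone \<Omega> xbar =
     {d. \<exists>x \<mu>. (\<forall>k::nat. x k \<in> \<Omega>) \<and> x \<longlonglongrightarrow> xbar \<and> (\<forall>k::nat. (\<mu> k :: real) \<ge> 0) \<and>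
               (\<lambda>k. \<mu> k *\<^sub>R (x k - xbar)) \<longlonglongrightarrow> d}"

definition bouligand_normal_cone :: "'a::real_inner set \<Rightarrow> 'a \<Rightarrow> 'a set" where
  "bouligand_normal_cone \<Omega> xbar =
     {d. \<forall>z \<in> bouligand_tangent_cone \<Omega> xbar. inner d z \<le> 0}"

definition bouligand_gradient ::
    "'a::euclidean_space set \<Rightarrow> ('a \<Rightarrow> real) \<Rightarrow> 'a \<Rightarrow> 'a set" where
  "bouligand_gradient S f x =
     {d. is_arg_min (\<lambda>d. norm (d + gradient f x)) (\<lambda>d. d \<in> bouligand_tangent_cone S x) d}"

definition alpha_stationary ::
    "real \<Rightarrow> 'a::euclidean_space set \<Rightarrow> ('a \<Rightarrow> real) \<Rightarrow> 'a \<Rightarrow> bool" where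
  "alpha_stationary \<alpha> S f x \<longleftrightarrow>
     x \<in> S \<and> x \<in> projection S (x - \<alpha> *\<^sub>R gradient f x)"

definition NB_stationary :: "'a::euclidean_space set \<Rightarrow> ('a \<Rightarrow> real) \<Rightarrow> 'a \<Rightarrow> bool" where
  "NB_stationary S f x \<longleftrightarrow>
     x \<in> S \<and> 0 \<in> (\<lambda>d. gradient f x + d) ` bouligand_normal_cone S x"

text \<open>The Bouligand gradient is set-valued; having norm zero means that its only
  element is the zero vector.\<close>

definition TB_stationary :: "'a::euclidean_space set \<Rightarrow> ('a \<Rightarrow> real) \<Rightarrow> 'a \<Rightarrow> bool" where
  "TB_stationary S f x \<longleftrightarrow> x \<in> S \<and> bouligand_gradient S f x = {0}"

end

theory Submission
  imports Defs
begin

text \<open>Every stationarity notion is tested on the coordinate directions along which the sparsity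
  constraint leaves \<open>x\<close> free to move: all of them if \<open>\<parallel>x\<parallel>\<^sub>0 < s\<close>, and only those in the support
  of \<open>x\<close> if \<open>\<parallel>x\<parallel>\<^sub>0 = s\<close>. These directions are feasible, and conversely every tangent vector is
  supported on them, because points near \<open>x\<close> have at least the support of \<open>x\<close>. Hence \<open>N\<^sup>B\<close>- and
  \<open>T\<^sup>B\<close>-stationarity both say that the gradient vanishes on the free coordinates, which
  \<open>\<alpha>\<close>-stationarity implies.\<close>

definition free_coords :: "nat \<Rightarrow> real ^ 'n \<Rightarrow> 'n set" where
  "free_coords s x = (if l0_norm x < s then UNIV else {i. x $ i \<noteq> 0})"

text \<open>The move can add at most \<open>i\<close> to the support. Either there is room for one
  more nonzero entry, or \<open>i\<close> lies in the support already.\<close>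

lemma sparse_set_add_axis:
  fixes x :: "real ^ 'n"
  assumes "x \<in> sparse_set s" and "i \<in> free_coords s x"
  shows "x + axis i t \<in> sparse_set s"
proof -
  have sub: "{j. (x + axis i t) $ j \<noteq> 0} \<subseteq> insert i {j. x $ j \<noteq> 0}"
    by (auto simp: axis_def)
  have "card (insert i {j. x $ j \<noteq> 0}) \<le> s"
    using assms
    by (auto simp: free_coords_def sparse_set_def l0_norm_def card_insert_if split: if_splits)
  then show ?thesis
    using card_mono[OF _ sub] by (simp add: sparse_set_def l0_norm_def)
qed

lemma bouligand_tangent_coneI:
  fixes x :: "'a::real_normed_vector"
  assumes "\<And>t. x + t *\<^sub>R d \<in> S"
  shows "d \<in> bouligand_tangent_cone S x"
proof -
  \<comment> \<open>With multipliers \<open>Suc k\<close>, the rescaled differences are constantly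
    \<open>d\<close>; the shift by one avoids division by zero at \<open>k = 0\<close>.\<close>
  define y where "y k = x + (1 / real (Suc k)) *\<^sub>R d" for k
  have "(\<lambda>k. x + (1 / real (Suc k)) *\<^sub>R d) \<longlonglongrightarrow> x + 0 *\<^sub>R d"
    by (intro tendsto_intros LIMSEQ_Suc[OF lim_1_over_n])
  then have "y \<longlonglongrightarrow> x"
    by (simp add: y_def[abs_def])
  moreover have "(\<lambda>k. real (Suc k) *\<^sub>R (y k - x)) \<longlonglongrightarrow> d"
    by (simp add: y_def del: of_nat_Suc)
  moreover have "\<forall>k. y k \<in> S"
    by (simp add: y_def assms)
  ultimately show ?thesis
    unfolding bouligand_tangent_cone_def
    by (intro CollectI exI[of _ y] exI[of _ "\<lambda>k. real (Suc k)"]) simp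
qed

lemma axis_mem_tangent_cone:
  fixes x :: "real ^ 'n"
  assumes "x \<in> sparse_set s" and "i \<in> free_coords s x"
  shows "axis i t \<in> bouligand_tangent_cone (sparse_set s) x"
proof (rule bouligand_tangent_coneI)
  fix r :: real
  have "r *\<^sub>R axis i t = axis i (r * t)"
    by (simp add: vec_eq_iff axis_def)
  then show "x + r *\<^sub>R axis i t \<in> sparse_set s"
    using sparse_set_add_axis[OF assms] by simp
qed

text \<open>If \<open>i\<close> is not free, \<open>x\<close> has at least \<open>s\<close> nonzero
  entries. Approximating points eventually keep all of them, so the bound \<open>s\<close> leaves no
  room for another one at \<open>i\<close>.\<close>

lemma tangent_cone_nth_eq_0:
  fixes x :: "real ^ 'n"
  assumes d: "d \<in> bouligand_tangent_cone (sparse_set s) x"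
    and i: "i \<notin> free_coords s x"
  shows "d $ i = 0"
proof -
  obtain y \<mu> where yS: "\<And>k. y k \<in> sparse_set s" and lim: "y \<longlonglongrightarrow> x"
    and limd: "(\<lambda>k. \<mu> k *\<^sub>R (y k - x)) \<longlonglongrightarrow> d"
    using d by (auto simp: bouligand_tangent_cone_def)
  have s: "s \<le> card {j. x $ j \<noteq> 0}" and xi: "x $ i = 0"
    using i by (auto simp: free_coords_def l0_norm_def split: if_splits)
  have "\<forall>\<^sub>F k in sequentially. x $ j \<noteq> 0 \<longrightarrow> y k $ j \<noteq> 0" for j
    using tendsto_imp_eventually_ne[OF tendsto_vec_nth[OF lim, of j], of 0]
    by (cases "x $ j = 0") auto
  \<comment> \<open>Finiteness of the index type makes the threshold uniform in
    \<open>j\<close>.\<close>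
  then have "\<forall>\<^sub>F k in sequentially. \<forall>j. x $ j \<noteq> 0 \<longrightarrow> y k $ j \<noteq> 0"
    by (rule eventually_all_finite)
  then have "\<forall>\<^sub>F k in sequentially. (\<mu> k *\<^sub>R (y k - x)) $ i = 0"
  proof eventually_elim
    case (elim k)
    then have "{j. x $ j \<noteq> 0} \<subseteq> {j. y k $ j \<noteq> 0}"
      by auto
    moreover have "card {j. y k $ j \<noteq> 0} \<le> card {j. x $ j \<noteq> 0}"
      using yS[of k] s by (simp add: sparse_set_def l0_norm_def)
    ultimately have "{j. x $ j \<noteq> 0} = {j. y k $ j \<noteq> 0}"
      by (intro card_seteq) auto
    then have "y k $ i = 0"
      using xi by auto
    then show ?case
      using xi by simp
  qed
  then have "(\<lambda>k. (\<mu> k *\<^sub>R (y k - x)) $ i) \<longlonglongrightarrow> 0"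
    by (rule tendsto_eventually)
  then show ?thesis
    using tendsto_vec_nth[OF limd, of i] LIMSEQ_unique by blast
qed

text \<open>In each coordinate one factor vanishes: that of \<open>g\<close> at free coordinates,
  that of \<open>d\<close> elsewhere.\<close>

lemma inner_tangent_cone_eq_0:
  fixes x g :: "real ^ 'n"
  assumes "d \<in> bouligand_tangent_cone (sparse_set s) x"
    and "\<forall>i\<in>free_coords s x. g $ i = 0"
  shows "inner g d = 0"
  unfolding inner_vec_def
  using tangent_cone_nth_eq_0[OF assms(1)] assms(2) by (intro sum.neutral) force

text \<open>The choice \<open>t = - v $ i\<close> erases the \<open>i\<close>-th entry and lowers
  the squared norm by its square.\<close>

lemma nth_eq_0_if_norm_le_norm_add_axis:
  fixes v :: "real ^ 'n"
  assumes "\<And>t. norm v \<le> norm (v + axis i t)"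
  shows "v $ i = 0"
proof -
  have "inner v v \<le> inner (v + axis i (- v $ i)) (v + axis i (- v $ i))"
    using assms[of "- v $ i"] by (simp add: norm_le)
  also have "\<dots> = inner v v - (v $ i)\<^sup>2"
    by (simp add: inner_add_left inner_add_right inner_axis inner_axis' power2_eq_square)
  finally show ?thesis
    by simp
qed

lemma NB_stationary_sparse_set_iff:
  fixes x :: "real ^ 'n"
  assumes x: "x \<in> sparse_set s"
  shows "NB_stationary (sparse_set s) f x \<longleftrightarrow> (\<forall>i\<in>free_coords s x. gradient f x $ i = 0)"
proof -
  let ?g = "gradient f x" and ?T = "bouligand_tangent_cone (sparse_set s) x"
  have "0 = ?g + d \<longleftrightarrow> d = - ?g" for d
    by (metis add.right_inverse add_left_cancel)
  then have "NB_stationary (sparse_set s) f x \<longleftrightarrow> (\<forall>z\<in>?T. 0 \<le> inner ?g z)"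
    using x by (simp add: NB_stationary_def bouligand_normal_cone_def image_iff)
  also have "\<dots> \<longleftrightarrow> (\<forall>i\<in>free_coords s x. ?g $ i = 0)"
  proof (intro iffI ballI)
    fix i
    assume "\<forall>z\<in>?T. 0 \<le> inner ?g z" and "i \<in> free_coords s x"
    \<comment> \<open>The sign is chosen so that the inner product is minus the square of the
      \<open>i\<close>-th gradient entry.\<close>
    then have "0 \<le> inner ?g (axis i (- ?g $ i))"
      using axis_mem_tangent_cone[OF x] by blast
    then have "?g $ i * ?g $ i \<le> 0"
      by (simp add: inner_axis)
    then show "?g $ i = 0"
      by (metis mult_eq_0_iff order_antisym zero_le_square)
  qed (simp add: inner_tangent_cone_eq_0)
  finally show ?thesis .
qed

lemma TB_stationary_sparse_set_iff:
  fixes x :: "real ^ 'n"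
  assumes x: "x \<in> sparse_set s"
  shows "TB_stationary (sparse_set s) f x \<longleftrightarrow> (\<forall>i\<in>free_coords s x. gradient f x $ i = 0)"
proof
  let ?g = "gradient f x" and ?T = "bouligand_tangent_cone (sparse_set s) x"
  show "\<forall>i\<in>free_coords s x. ?g $ i = 0" if TB: "TB_stationary (sparse_set s) f x"
  proof
    fix i assume i: "i \<in> free_coords s x"
    have "0 \<in> bouligand_gradient (sparse_set s) f x"
      using TB by (simp add: TB_stationary_def)
    then have "norm ?g \<le> norm (d + ?g)" if "d \<in> ?T" for d
      using that by (auto simp: bouligand_gradient_def is_arg_min_linorder)
    then show "?g $ i = 0"
      using axis_mem_tangent_cone[OF x i]
      by (intro nth_eq_0_if_norm_le_norm_add_axis) (metis add.commute)
  qed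
  assume g: "\<forall>i\<in>free_coords s x. ?g $ i = 0"
  \<comment> \<open>By orthogonality the squared norm of \<open>d + ?g\<close> is the sum of those
    of \<open>d\<close> and \<open>?g\<close>. Strictness for \<open>d \<noteq> 0\<close> makes 0
    the only minimizer.\<close>
  have less: "norm ?g < norm (d + ?g)" if "d \<in> ?T" "d \<noteq> 0" for d
    using inner_tangent_cone_eq_0[OF that(1) g] that(2)
    by (simp add: norm_lt inner_add_left inner_add_right inner_commute)
  have zero: "0 \<in> ?T"
    using x by (intro bouligand_tangent_coneI) simp
  have "d \<in> bouligand_gradient (sparse_set s) f x \<longleftrightarrow> d = 0" for d
    using zero less
    by (cases "d = 0") (force simp: bouligand_gradient_def is_arg_min_def)+
  then show "TB_stationary (sparse_set s) f x"
    using x by (auto simp: TB_stationary_def)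
qed

text \<open>Against the competitors \<open>x + axis i t\<close>, the projection inequality says that
  moving \<open>\<alpha> *\<^sub>R gradient f x\<close> along the \<open>i\<close>-th axis never
  shortens it.\<close>

lemma alpha_stationary_sparse_set_imp:
  fixes x :: "real ^ 'n"
  assumes "\<alpha> \<noteq> 0"
    and stat: "alpha_stationary \<alpha> (sparse_set s) f x"
    and i: "i \<in> free_coords s x"
  shows "gradient f x $ i = 0"
proof -
  let ?v = "\<alpha> *\<^sub>R gradient f x"
  have x: "x \<in> sparse_set s"
    using stat by (simp add: alpha_stationary_def)
  have min: "norm (x - ?v - x) \<le> norm (x - ?v - y)" if "y \<in> sparse_set s" for y
    using stat that by (simp add: alpha_stationary_def projection_def is_arg_min_linorder)
  have "norm ?v \<le> norm (?v + axis i t)" for t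
  proof -
    have "x - ?v - (x + axis i t) = - (?v + axis i t)"
      by simp
    then show ?thesis
      using min[OF sparse_set_add_axis[OF x i], of t] by (simp only: norm_minus_cancel) simp
  qed
  then have "?v $ i = 0"
    by (rule nth_eq_0_if_norm_le_norm_add_axis)
  then show ?thesis
    using \<open>\<alpha> \<noteq> 0\<close> by simp
qed

text \<open>The point to be projected is then \<open>x\<close> itself, at distance 0 from
  \<open>S\<close>.\<close>

lemma alpha_stationary_if_gradient_eq_0:
  assumes "x \<in> S" and "gradient f x = 0"
  shows "alpha_stationary \<alpha> S f x"
  using assms by (simp add: alpha_stationary_def projection_def is_arg_min_linorder)

theorem theorem2p3:
  fixes f :: "real ^ 'n \<Rightarrow> real"
    and s :: nat
    and \<alpha> :: real
    and x :: "real ^ 'n"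
  assumes s_pos: "0 < s"
    and s_less: "s < CARD('n)"
    and f_C1: "continuously_differentiable f"
    and alpha_pos: "\<alpha> > 0"
    and x_in: "x \<in> sparse_set s"
  shows "(l0_norm x = s \<longrightarrow>
            (alpha_stationary \<alpha> (sparse_set s) f x \<longrightarrow> NB_stationary (sparse_set s) f x) \<and>
            (NB_stationary (sparse_set s) f x \<longleftrightarrow> TB_stationary (sparse_set s) f x)) \<and>
         (l0_norm x < s \<longrightarrow>
            (alpha_stationary \<alpha> (sparse_set s) f x \<longleftrightarrow> NB_stationary (sparse_set s) f x) \<and>
            (NB_stationary (sparse_set s) f x \<longleftrightarrow> TB_stationary (sparse_set s) f x) \<and>
            (TB_stationary (sparse_set s) f x \<longleftrightarrow> gradient f x = 0))"
proof -
  have imp: "alpha_stationary \<alpha> (sparse_set s) f x \<longrightarrow> (\<forall>i\<in>free_coords s x. gradient f x $ i = 0)"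
    using alpha_stationary_sparse_set_imp[of \<alpha> s f x] alpha_pos by simp
  \<comment> \<open>Below the sparsity bound every coordinate is free, so the common criterion
    becomes a vanishing gradient, which leads back to \<alpha>-stationarity.\<close>
  have "(\<forall>i\<in>free_coords s x. gradient f x $ i = 0) \<longleftrightarrow> gradient f x = 0" if "l0_norm x < s"
    using that by (simp add: free_coords_def vec_eq_iff)
  then show ?thesis
    using imp alpha_stationary_if_gradient_eq_0[OF x_in]
    unfolding NB_stationary_sparse_set_iff[OF x_in] TB_stationary_sparse_set_iff[OF x_in]
    by blast
qed

end
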